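(* For $m\geq 2$ and $n\geq 0$, $$X_{L_{m,n}}=(m-1)X_{L_{m-1,n+1}}-(m-2)X_{K_{m-1}}X_{P_{n+1}}.$$
   Context: All graphs are finite and simple. For a graph $G$ with vertex set $\{v_1,\dots,v_N\}$, the chromatic symmetric function is $X_G=\sum_\kappa x_{\kappa(v_1)}\cdots x_{\kappa(v_N)}$, summed over all proper colourings $\kappa:V\to\{1,2,\dots\}$ (adjacent vertices get different colours); $X_\emptyset=1$. $K_m$ ($m\geq1$) is the complete graph on $m$ vertices; $P_n$ ($n\geq1$) is the path on $n$ vertices ($P_1=K_1$). For $m,n\geq 1$ the lollipop graph $L_{m,n}$ is obtained from the disjoint union of $K_m$ and $P_n$ by adding an edge joining one vertex of $K_m$ to an end vertex (degree $\leq 1$ vertex) of $P_n$. Conventions: $K_0=P_0=L_{0,0}=\emptyset$ (empty graph), $L_{m,0}=K_m$, $L_{0,n}=P_n$. *)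

theory Defs
  imports "HOL-Library.Multiset" "HOL-Library.FuncSet"
begin

section \<open>Formal power series in the indeterminates $x_0, x_1, x_2, \dots$\<close>

text \<open>
  A monomial is the multiset of the indices of its indeterminates, so that the product of monomials
  is the sum of multisets. A series is an arbitrary coefficient function on monomials.
\<close>

typedef series = "UNIV :: (nat multiset \<Rightarrow> int) set"
  morphisms coeff Series ..

lemma coeff_Series [simp]: "coeff (Series f) = f"
  by (simp add: Series_inverse)

lemma series_eqI: "(\<And>M. coeff f M = coeff g M) \<Longrightarrow> f = g"
  by (metis coeff_inject ext)

lemma finite_submultisets: "finite {A. A \<subseteq># (M :: 'a multiset)}"
proof (induction M)
  case empty
  then show ?case by simp
next
  case (add x M)
  have "{A. A \<subseteq># add_mset x M} \<subseteq> {A. A \<subseteq># M} \<union> add_mset x ` {A. A \<subseteq># M}"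
  proof
    fix A assume A: "A \<in> {A. A \<subseteq># add_mset x M}"
    show "A \<in> {A. A \<subseteq># M} \<union> add_mset x ` {A. A \<subseteq># M}"
    proof (cases "x \<in># A")
      case True
      then obtain B where "A = add_mset x B" by (metis insert_DiffM)
      with A show ?thesis by auto
    next
      case False
      have "count A y \<le> count M y" for y
        using A False mset_subset_eq_count[of A "add_mset x M" y]
        by (cases "y = x") (auto simp: not_in_iff)
      then show ?thesis by (simp add: mset_subset_eqI)
    qed
  qed
  with add.IH show ?case by (meson finite_UnI finite_imageI finite_subset)
qed

instantiation series :: comm_ring_1
begin

definition "0 = Series (\<lambda>M. 0)"
definition "1 = Series (\<lambda>M. if M = {#} then 1 else 0)"
definition "f + g = Series (\<lambda>M. coeff f M + coeff g M)"
definition "f - g = Series (\<lambda>M. coeff f M - coeff g M)"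
definition "- f = Series (\<lambda>M. - coeff f M)"
definition "f * g = Series (\<lambda>M. \<Sum>A | A \<subseteq># M. coeff f A * coeff g (M - A))"

instance
proof
  fix f g h :: series
  show "f * g * h = f * (g * h)"
  proof (rule series_eqI)
    fix M
    have "coeff (f * g * h) M = (\<Sum>B | B \<subseteq># M. \<Sum>A | A \<subseteq># B. coeff f A * coeff g (B - A) * coeff h (M - B))"
      by (simp add: times_series_def sum_distrib_right)
    also have "\<dots> = (\<Sum>(B, A)\<in>(SIGMA B:{B. B \<subseteq># M}. {A. A \<subseteq># B}). coeff f A * coeff g (B - A) * coeff h (M - B))"
      by (rule sum.Sigma) (auto simp: finite_submultisets)
    also have "\<dots> = (\<Sum>(A, C)\<in>(SIGMA A:{A. A \<subseteq># M}. {C. C \<subseteq># M - A}). coeff f A * (coeff g C * coeff h (M - A - C)))"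
    proof (rule sum.reindex_bij_witness[where i = "\<lambda>(A, C). (A + C, A)" and j = "\<lambda>(B, A). (A, B - A)"])
      fix a assume "a \<in> (SIGMA B:{B. B \<subseteq># M}. {A. A \<subseteq># B})"
      then obtain B A where a: "a = (B, A)" "A \<subseteq># B" "B \<subseteq># M" by auto
      then show "(case case a of (B, A) \<Rightarrow> (A, B - A) of (A, C) \<Rightarrow> (A + C, A)) = a" by simp
      show "(case a of (B, A) \<Rightarrow> (A, B - A)) \<in> (SIGMA A:{A. A \<subseteq># M}. {C. C \<subseteq># M - A})"
        using a by (auto simp: subseteq_mset_def diff_le_mono intro: order_trans)
      have "M - A - (B - A) = M - B" using a by (simp add: multiset_eq_iff subseteq_mset_def)
      then show "(case case a of (B, A) \<Rightarrow> (A, B - A) of (A, C) \<Rightarrow> coeff f A * (coeff g C * coeff h (M - A - C))) =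
        (case a of (B, A) \<Rightarrow> coeff f A * coeff g (B - A) * coeff h (M - B))"
        using a by (simp add: mult.assoc)
    next
      fix b assume "b \<in> (SIGMA A:{A. A \<subseteq># M}. {C. C \<subseteq># M - A})"
      then obtain A C where b: "b = (A, C)" "A \<subseteq># M" "C \<subseteq># M - A" by auto
      then show "(case case b of (A, C) \<Rightarrow> (A + C, A) of (B, A) \<Rightarrow> (A, B - A)) = b" by simp
      show "(case b of (A, C) \<Rightarrow> (A + C, A)) \<in> (SIGMA B:{B. B \<subseteq># M}. {A. A \<subseteq># B})"
        using b by (simp add: subset_mset.le_diff_conv2 add.commute)
    qed
    also have "\<dots> = (\<Sum>A | A \<subseteq># M. \<Sum>C | C \<subseteq># M - A. coeff f A * (coeff g C * coeff h (M - A - C)))"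
      by (rule sum.Sigma[symmetric]) (auto simp: finite_submultisets)
    also have "\<dots> = coeff (f * (g * h)) M"
      by (simp add: times_series_def sum_distrib_left)
    finally show "coeff (f * g * h) M = coeff (f * (g * h)) M" .
  qed
  show "f * g = g * f"
  proof (rule series_eqI)
    fix M :: "nat multiset"
    have double_diff: "M - (M - A) = A" if "A \<subseteq># M" for A
      using that by (simp add: multiset_eq_iff subseteq_mset_def)
    have "(\<Sum>A | A \<subseteq># M. coeff f A * coeff g (M - A)) = (\<Sum>A | A \<subseteq># M. coeff g A * coeff f (M - A))"
      by (rule sum.reindex_bij_witness[where i = "\<lambda>A. M - A" and j = "\<lambda>A. M - A"])
        (auto simp: double_diff)
    then show "coeff (f * g) M = coeff (g * f) M" by (simp add: times_series_def)
  qed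
  show "1 * f = f"
  proof (rule series_eqI)
    fix M
    have "(\<Sum>A | A \<subseteq># M. (if A = {#} then 1 else 0) * coeff f (M - A)) =
        (\<Sum>A | A \<subseteq># M. if A = {#} then coeff f M else 0)"
      by (intro sum.cong) auto
    then show "coeff (1 * f) M = coeff f M"
      by (simp add: times_series_def one_series_def finite_submultisets)
  qed
  show "(f + g) * h = f * h + g * h"
    by (rule series_eqI) (simp add: times_series_def plus_series_def distrib_right sum.distrib)
  show "(0 :: series) \<noteq> 1"
  proof
    assume "(0 :: series) = 1"
    then have "coeff 0 {#} = coeff 1 {#}" by (rule arg_cong)
    then show False by (simp add: zero_series_def one_series_def)
  qed
  show "f + g + h = f + (g + h)" "f + g = g + f" "0 + f = f" "- f + f = 0" "f - g = f + - g"
    by (rule series_eqI, simp add: plus_series_def minus_series_def uminus_series_def zero_series_def)+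
qed

end

definition indet :: "nat \<Rightarrow> series" where
  "indet i = Series (\<lambda>M. if M = {#i#} then 1 else 0)"

text \<open>
  The coefficientwise sum of a possibly infinite family, meaningful when every monomial has a
  nonzero coefficient in only finitely many members.
\<close>

definition series_sum :: "('i \<Rightarrow> series) \<Rightarrow> 'i set \<Rightarrow> series" where
  "series_sum f I = Series (\<lambda>M. \<Sum>i | i \<in> I \<and> coeff (f i) M \<noteq> 0. coeff (f i) M)"


section \<open>Graphs and the chromatic symmetric function\<close>

text \<open>A graph is a pair of a vertex set and a set of two-element sets of vertices.\<close>

type_synonym 'a graph = "'a set \<times> 'a set set"

definition simple_graph :: "'a graph \<Rightarrow> bool" where
  "simple_graph G \<longleftrightarrow> finite (fst G) \<and> (\<forall>e\<in>snd G. e \<subseteq> fst G \<and> card e = 2)"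

definition proper_colourings :: "'a graph \<Rightarrow> ('a \<Rightarrow> nat) set" where
  "proper_colourings G = {\<kappa> \<in> fst G \<rightarrow>\<^sub>E {1..}. \<forall>u v. {u, v} \<in> snd G \<longrightarrow> \<kappa> u \<noteq> \<kappa> v}"

definition chromatic_sf :: "'a graph \<Rightarrow> series" where
  "chromatic_sf G = series_sum (\<lambda>\<kappa>. \<Prod>v\<in>fst G. indet (\<kappa> v)) (proper_colourings G)"

definition complete_graph :: "nat \<Rightarrow> nat graph" where
  "complete_graph m = ({..<m}, {e. e \<subseteq> {..<m} \<and> card e = 2})"

definition path_graph :: "nat \<Rightarrow> nat graph" where
  "path_graph n = ({..<n}, {{i, Suc i} | i. Suc i < n})"

text \<open>
  The path is shifted by \<open>m\<close> to make it disjoint from the complete graph; then its end vertex \<open>m\<close>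
  is joined to the vertex \<open>m - 1\<close> of the complete graph.
\<close>

definition lollipop_graph :: "nat \<Rightarrow> nat \<Rightarrow> nat graph" where
  "lollipop_graph m n =
    (if n = 0 then complete_graph m
     else if m = 0 then path_graph n
     else (fst (complete_graph m) \<union> (+) m ` fst (path_graph n),
           snd (complete_graph m) \<union> (`) ((+) m) ` snd (path_graph n) \<union> {{m - 1, m}}))"

lemma simple_graph_complete: "simple_graph (complete_graph m)"
  by (auto simp: simple_graph_def complete_graph_def)

lemma simple_graph_path: "simple_graph (path_graph n)"
  by (auto simp: simple_graph_def path_graph_def)

lemma simple_graph_lollipop: "simple_graph (lollipop_graph m n)"
proof (cases "n = 0 \<or> m = 0")
  case True
  then show ?thesis
    by (auto simp: lollipop_graph_def simple_graph_complete simple_graph_path)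
next
  case False
  have c: "card ((+) m ` e) = card e" for e :: "nat set"
    by (simp add: card_image)
  have "e \<subseteq> fst (lollipop_graph m n) \<and> card e = 2" if "e \<in> snd (lollipop_graph m n)" for e
  proof -
    from that False consider "e \<in> snd (complete_graph m)"
      | d where "d \<in> snd (path_graph n)" "e = (+) m ` d" | "e = {m - 1, m}"
      by (auto simp: lollipop_graph_def)
    then show ?thesis
    proof cases
      case 1
      then show ?thesis
        using False simple_graph_complete[of m] by (auto simp: simple_graph_def lollipop_graph_def)
    next
      case 2
      then have "d \<subseteq> fst (path_graph n)" "card d = 2"
        using simple_graph_path[of n] by (auto simp: simple_graph_def)
      then show ?thesis
        using False 2 c by (auto simp: lollipop_graph_def)
    next
      case 3
      then show ?thesis
        using False by (auto simp: lollipop_graph_def complete_graph_def path_graph_def)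
    qed
  qed
  moreover have "finite (fst (lollipop_graph m n))"
    by (simp add: lollipop_graph_def complete_graph_def path_graph_def)
  ultimately show ?thesis by (simp add: simple_graph_def)
qed

lemma coeff_prod_indet:
  assumes "finite V"
  shows "coeff (\<Prod>v\<in>V. indet (\<kappa> v)) M = (if M = image_mset \<kappa> (mset_set V) then 1 else 0)"
  using assms
proof (induction V arbitrary: M rule: finite_induct)
  case empty
  then show ?case by (simp add: one_series_def)
next
  case (insert v V)
  have "coeff (\<Prod>u\<in>insert v V. indet (\<kappa> u)) M =
      (\<Sum>A | A \<subseteq># M. if A = {#\<kappa> v#} then (if M - {#\<kappa> v#} = image_mset \<kappa> (mset_set V) then 1 else 0) else 0)"
    unfolding prod.insert[OF insert.hyps] times_series_def coeff_Series insert.IH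
    by (intro sum.cong) (auto simp: indet_def)
  also have "\<dots> = (if \<kappa> v \<in># M \<and> M - {#\<kappa> v#} = image_mset \<kappa> (mset_set V) then 1 else 0)"
    by (simp add: finite_submultisets)
  also have "\<dots> = (if M = image_mset \<kappa> (mset_set (insert v V)) then 1 else 0)"
    using insert by (auto dest: insert_DiffM)
  finally show ?case .
qed

text \<open>The family defining the chromatic symmetric function is summable.\<close>

lemma finite_colourings_monomial:
  assumes "finite (fst G)"
  shows "finite {\<kappa> \<in> proper_colourings G. image_mset \<kappa> (mset_set (fst G)) = M}"
proof (rule finite_subset)
  show "{\<kappa> \<in> proper_colourings G. image_mset \<kappa> (mset_set (fst G)) = M} \<subseteq> fst G \<rightarrow>\<^sub>E set_mset M"
    using assms by (auto simp: proper_colourings_def PiE_iff extensional_def)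
  show "finite (fst G \<rightarrow>\<^sub>E set_mset M)"
    using assms by (intro finite_PiE) auto
qed

lemma coeff_chromatic_sf:
  assumes "finite (fst G)"
  shows "coeff (chromatic_sf G) M =
    int (card {\<kappa> \<in> proper_colourings G. image_mset \<kappa> (mset_set (fst G)) = M})"
proof -
  have "coeff (chromatic_sf G) M =
      (\<Sum>\<kappa> | \<kappa> \<in> proper_colourings G \<and> image_mset \<kappa> (mset_set (fst G)) = M. 1)"
    unfolding chromatic_sf_def series_sum_def coeff_Series coeff_prod_indet[OF assms]
    by (intro sum.cong) auto
  then show ?thesis by simp
qed

end

theory Submission
  imports Defs "HOL-Combinatorics.Transposition"
begin

text \<open>
  Let \<open>G\<close> be the disjoint union of \<open>K\<^sub>m\<^sub>-\<^sub>1\<close> and \<open>P\<^sub>n\<^sub>+\<^sub>1\<close>, and let \<open>w\<close> be an end vertex of the path. In a proper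
  colouring of \<open>G\<close> the colour of \<open>w\<close> occurs at most once in the clique, so the indicator that it does
  not occur equals the number of clique vertices coloured differently from \<open>w\<close>, minus \<open>m - 2\<close>.
  Joining \<open>w\<close> to the whole clique gives \<open>L\<^sub>m\<^sub>,\<^sub>n\<close>; joining it to any single clique vertex gives a graph
  isomorphic to \<open>L\<^sub>m\<^sub>-\<^sub>1\<^sub>,\<^sub>n\<^sub>+\<^sub>1\<close>.
\<close>

section \<open>Coefficient extraction from ring expressions\<close>

lemma coeff_plus: "coeff (f + g) M = coeff f M + coeff g M"
  by (simp add: plus_series_def)

lemma coeff_minus: "coeff (f - g) M = coeff f M - coeff g M"
  by (simp add: minus_series_def)

lemma coeff_zero: "coeff 0 M = 0"
  by (simp add: zero_series_def)

lemma coeff_sum: "coeff (sum f I) M = (\<Sum>i\<in>I. coeff (f i) M)"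
  by (induction I rule: infinite_finite_induct) (simp_all add: coeff_zero coeff_plus)

lemma coeff_of_nat_mult: "coeff (of_nat k * f) M = int k * coeff f M"
  by (induction k) (simp_all add: coeff_zero coeff_plus distrib_right)

section \<open>Behaviour under relabelling, disjoint union and added edges\<close>

lemma simple_graph_edge:
  assumes "simple_graph G" "{u, v} \<in> snd G"
  shows "u \<in> fst G" "v \<in> fst G" "u \<noteq> v"
  using assms by (auto simp: simple_graph_def)

lemma image_mset_restrict:
  "finite V \<Longrightarrow> image_mset (restrict f V) (mset_set V) = image_mset f (mset_set V)"
  by (rule image_mset_cong) simp

text \<open>Pulling colourings back along \<open>f\<close> is a bijection that preserves the
  multiset of colours, so every coefficient, being a count of such colourings, agrees. It serves
  both to shift the path and to move the attaching edge.\<close>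

lemma chromatic_sf_image:
  assumes G: "simple_graph G" and f: "inj_on f (fst G)"
  shows "chromatic_sf (f ` fst G, (`) f ` snd G) = chromatic_sf G"
proof (rule series_eqI)
  fix M
  let ?H = "(f ` fst G, (`) f ` snd G)"
  have fin: "finite (fst G)" using G by (simp add: simple_graph_def)
  \<comment> \<open>An edge of the image only gives an equality of unordered pairs, so the chosen
    endpoints may have to be swapped.\<close>
  have edge: "\<exists>a b. {a, b} \<in> snd G \<and> a \<in> fst G \<and> b \<in> fst G \<and> u = f a \<and> v = f b"
    if "{u, v} \<in> snd ?H" for u v
  proof -
    from that obtain e where e: "e \<in> snd G" "{u, v} = f ` e" by auto
    then obtain a b where ab: "e = {a, b}"
      using G by (auto simp: simple_graph_def card_2_iff)
    then have "a \<in> fst G" "b \<in> fst G" using G e(1) by (auto simp: simple_graph_def)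
    moreover have "{u, v} = {f a, f b}" using e ab by simp
    then have "u = f a \<and> v = f b \<or> u = f b \<and> v = f a" by (auto simp: doubleton_eq_iff)
    ultimately show ?thesis using e(1) ab by (metis insert_commute)
  qed
  have img: "image_mset \<kappa> (mset_set (f ` fst G)) = image_mset (\<lambda>x. \<kappa> (f x)) (mset_set (fst G))" for \<kappa> :: "'b \<Rightarrow> nat"
    by (simp add: image_mset_mset_set[OF f, symmetric] multiset.map_comp comp_def)
  \<comment> \<open>Colourings are extensional, hence the restrictions in both directions.\<close>
  let ?i = "\<lambda>\<kappa>. restrict (\<lambda>y. \<kappa> (inv_into (fst G) f y)) (f ` fst G)"
  let ?j = "\<lambda>\<kappa>. restrict (\<lambda>x. \<kappa> (f x)) (fst G)"
  let ?A = "{\<kappa> \<in> proper_colourings ?H. image_mset \<kappa> (mset_set (f ` fst G)) = M}"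
  let ?B = "{\<kappa> \<in> proper_colourings G. image_mset \<kappa> (mset_set (fst G)) = M}"
  have "bij_betw ?j ?A ?B"
  proof (rule bij_betw_byWitness[where f' = ?i])
    show "\<forall>\<kappa>\<in>?A. ?i (?j \<kappa>) = \<kappa>"
      using f by (auto simp: proper_colourings_def PiE_iff extensional_def fun_eq_iff inv_into_into f_inv_into_f)
    show "\<forall>\<kappa>\<in>?B. ?j (?i \<kappa>) = \<kappa>"
      using f by (auto simp: proper_colourings_def PiE_iff extensional_def fun_eq_iff)
    show "?j ` ?A \<subseteq> ?B"
    proof (rule image_subsetI)
      fix \<kappa> assume \<kappa>: "\<kappa> \<in> ?A"
      have "\<kappa> (f u) \<noteq> \<kappa> (f v)" if "{u, v} \<in> snd G" for u v
      proof -
        have "{f u, f v} \<in> snd ?H" using imageI[OF that, of "(`) f"] by simp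
        then show ?thesis using \<kappa> unfolding proper_colourings_def mem_Collect_eq by metis
      qed
      moreover have "image_mset (?j \<kappa>) (mset_set (fst G)) = M"
        using \<kappa> by (simp add: img image_mset_restrict[OF fin])
      ultimately show "?j \<kappa> \<in> ?B"
        using \<kappa> simple_graph_edge[OF G] by (auto simp: proper_colourings_def PiE_iff)
    qed
    show "?i ` ?B \<subseteq> ?A"
    proof (rule image_subsetI)
      fix \<kappa> assume \<kappa>: "\<kappa> \<in> ?B"
      have "?i \<kappa> u \<noteq> ?i \<kappa> v" if uv: "{u, v} \<in> snd ?H" for u v
      proof -
        obtain a b where "{a, b} \<in> snd G" "a \<in> fst G" "b \<in> fst G" "u = f a" "v = f b"
          using edge[OF uv] by blast
        then show ?thesis using \<kappa> f by (simp add: proper_colourings_def)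
      qed
      moreover have "image_mset (?i \<kappa>) (mset_set (f ` fst G)) = M"
      proof -
        have "image_mset (?i \<kappa>) (mset_set (f ` fst G)) = image_mset \<kappa> (mset_set (fst G))"
          unfolding img using fin f by (intro image_mset_cong) simp
        then show ?thesis using \<kappa> by simp
      qed
      moreover have "?i \<kappa> \<in> fst ?H \<rightarrow>\<^sub>E {1..}"
        using \<kappa> f by (auto simp: proper_colourings_def PiE_iff)
      ultimately show "?i \<kappa> \<in> ?A"
        by (simp only: proper_colourings_def mem_Collect_eq) blast
    qed
  qed
  then have "card ?A = card ?B" by (rule bij_betw_same_card)
  then show "coeff (chromatic_sf ?H) M = coeff (chromatic_sf G) M"
    using fin by (simp add: coeff_chromatic_sf)
qed

text \<open>A colouring of the union is a pair of independent colourings; splitting its colour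
  multiset into the two parts gives exactly the convolution that defines the product of
  series.\<close>

lemma chromatic_sf_disjoint_union:
  assumes G: "simple_graph G" and H: "simple_graph H" and disj: "fst G \<inter> fst H = {}"
  shows "chromatic_sf (fst G \<union> fst H, snd G \<union> snd H) = chromatic_sf G * chromatic_sf H"
proof (rule series_eqI)
  fix M
  let ?U = "(fst G \<union> fst H, snd G \<union> snd H)"
  have fin: "finite (fst G)" "finite (fst H)" using G H by (simp_all add: simple_graph_def)
  let ?c = "\<lambda>F A. {\<kappa> \<in> proper_colourings F. image_mset \<kappa> (mset_set (fst F)) = A}"
  \<comment> \<open>The multiset \<open>A\<close> is determined by the first colouring, but
    recording it makes the cardinality of \<open>?S\<close> the convolution sum.\<close>
  let ?S = "SIGMA A:{A. A \<subseteq># M}. ?c G A \<times> ?c H (M - A)"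
  let ?j = "\<lambda>\<kappa>. (image_mset \<kappa> (mset_set (fst G)), restrict \<kappa> (fst G), restrict \<kappa> (fst H))"
  let ?i = "\<lambda>(A, \<mu>, \<nu>) x. if x \<in> fst G then \<mu> x else \<nu> x"
  have ms: "mset_set (fst G \<union> fst H) = mset_set (fst G) + mset_set (fst H)"
    using fin disj by (rule mset_set_Union)
  have "bij_betw ?j (?c ?U M) ?S"
  proof (rule bij_betw_byWitness[where f' = ?i])
    show "\<forall>\<kappa>\<in>?c ?U M. ?i (?j \<kappa>) = \<kappa>"
      by (auto simp: proper_colourings_def PiE_iff extensional_def fun_eq_iff)
    show "\<forall>p\<in>?S. ?j (?i p) = p"
    proof
      fix p assume "p \<in> ?S"
      then obtain A \<mu> \<nu> where p: "p = (A, \<mu>, \<nu>)" "\<mu> \<in> ?c G A" "\<nu> \<in> ?c H (M - A)" by auto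
      have "restrict (?i p) (fst G) = \<mu>" "restrict (?i p) (fst H) = \<nu>"
        using p disj by (auto simp: proper_colourings_def PiE_iff extensional_def fun_eq_iff)
      moreover from this(1) have "image_mset (?i p) (mset_set (fst G)) = A"
        using p(2) image_mset_restrict[OF fin(1), of "?i p"] by simp
      ultimately show "?j (?i p) = p" using p(1) by simp
    qed
    show "?j ` ?c ?U M \<subseteq> ?S"
    proof (rule image_subsetI)
      fix \<kappa> assume "\<kappa> \<in> ?c ?U M"
      then have \<kappa>: "\<kappa> \<in> fst G \<union> fst H \<rightarrow>\<^sub>E {1..}"
        "image_mset \<kappa> (mset_set (fst G)) + image_mset \<kappa> (mset_set (fst H)) = M"
        "\<And>u v. {u, v} \<in> snd G \<or> {u, v} \<in> snd H \<Longrightarrow> \<kappa> u \<noteq> \<kappa> v"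
        by (auto simp: proper_colourings_def ms)
      have "restrict \<kappa> (fst G) \<in> proper_colourings G" "restrict \<kappa> (fst H) \<in> proper_colourings H"
        using \<kappa>(1,3) simple_graph_edge[OF G] simple_graph_edge[OF H]
        by (auto simp: proper_colourings_def PiE_iff)
      then show "?j \<kappa> \<in> ?S" using \<kappa>(2) image_mset_restrict fin by auto
    qed
    show "?i ` ?S \<subseteq> ?c ?U M"
    proof (rule image_subsetI)
      fix p assume "p \<in> ?S"
      then obtain A \<mu> \<nu> where p: "p = (A, \<mu>, \<nu>)" "A \<subseteq># M" "\<mu> \<in> ?c G A" "\<nu> \<in> ?c H (M - A)" by auto
      have G_eq: "?i p x = \<mu> x" if "x \<in> fst G" for x using that p(1) by simp
      have H_eq: "?i p x = \<nu> x" if "x \<in> fst H" for x using that p(1) disj by auto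
      have "?i p u \<noteq> ?i p v" if "{u, v} \<in> snd G \<union> snd H" for u v
        using that
      proof
        assume e: "{u, v} \<in> snd G"
        then show ?thesis
          using p(3) by (simp only: G_eq simple_graph_edge[OF G e]) (simp add: proper_colourings_def)
      next
        assume e: "{u, v} \<in> snd H"
        then show ?thesis
          using p(4) by (simp only: H_eq simple_graph_edge[OF H e]) (simp add: proper_colourings_def)
      qed
      moreover have "?i p \<in> fst G \<union> fst H \<rightarrow>\<^sub>E {1..}"
        using p by (auto simp: proper_colourings_def PiE_iff extensional_def)
      moreover have "image_mset (?i p) (mset_set (fst G)) = image_mset \<mu> (mset_set (fst G))"
        "image_mset (?i p) (mset_set (fst H)) = image_mset \<nu> (mset_set (fst H))"
        using fin by (auto intro!: image_mset_cong simp only: G_eq H_eq elem_mset_set)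
      then have "image_mset (?i p) (mset_set (fst G \<union> fst H)) = M"
        using p(2-4) by (simp only: ms image_mset_union) auto
      ultimately show "?i p \<in> ?c ?U M" by (simp only: proper_colourings_def mem_Collect_eq fst_conv snd_conv) blast
    qed
  qed
  then have "card (?c ?U M) = card ?S" by (rule bij_betw_same_card)
  also have "\<dots> = (\<Sum>A | A \<subseteq># M. card (?c G A) * card (?c H (M - A)))"
    using fin by (subst card_SigmaI)
      (auto simp: finite_submultisets card_cartesian_product intro!: finite_cartesian_product finite_colourings_monomial)
  finally show "coeff (chromatic_sf ?U) M = coeff (chromatic_sf G * chromatic_sf H) M"
    using fin by (simp add: times_series_def coeff_chromatic_sf)
qed

text \<open>All graphs involved share the vertex set \<open>V\<close>, so the identity can be
  checked on each colouring of \<open>(V, E)\<close> separately. The subtraction of 1 takes place in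
  the ring, which keeps the formula correct for empty \<open>C\<close>.\<close>

lemma chromatic_sf_join_vertex_clique:
  assumes V: "finite V" and C: "C \<subseteq> V"
    and clique: "\<And>c d. c \<in> C \<Longrightarrow> d \<in> C \<Longrightarrow> c \<noteq> d \<Longrightarrow> {c, d} \<in> E"
  shows "chromatic_sf (V, E \<union> (\<lambda>c. {c, w}) ` C) =
    (\<Sum>c\<in>C. chromatic_sf (V, insert {c, w} E)) - (of_nat (card C) - 1) * chromatic_sf (V, E)"
proof (rule series_eqI)
  fix M
  have finC: "finite C" using V C by (rule rev_finite_subset)
  let ?c = "\<lambda>F. {\<kappa> \<in> proper_colourings (V, F). image_mset \<kappa> (mset_set V) = M}"
  have finB: "finite (?c E)" using finite_colourings_monomial[of "(V, E)" M] V by simp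
  have ins: "?c (insert {c, w} E) = {\<kappa> \<in> ?c E. \<kappa> c \<noteq> \<kappa> w}" for c
    by (auto simp: proper_colourings_def doubleton_eq_iff)
  have all: "?c (E \<union> (\<lambda>c. {c, w}) ` C) = {\<kappa> \<in> ?c E. \<forall>c\<in>C. \<kappa> c \<noteq> \<kappa> w}"
    by (auto simp: proper_colourings_def image_iff doubleton_eq_iff)
  \<comment> \<open>Indicator sums over the common index set \<open>?c E\<close> turn the pointwise
    identity \<open>count\<close> into one between cardinalities.\<close>
  have card_filter: "int (card {\<kappa> \<in> ?c E. P \<kappa>}) = (\<Sum>\<kappa>\<in>?c E. of_bool (P \<kappa>))" for P
    using finB by (simp add: of_bool_def sum.If_cases Int_def)
  have count: "of_bool (\<forall>c\<in>C. \<kappa> c \<noteq> \<kappa> w) = (\<Sum>c\<in>C. of_bool (\<kappa> c \<noteq> \<kappa> w)) - (int (card C) - 1)"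
    if "\<kappa> \<in> ?c E" for \<kappa>
  proof (cases "\<forall>c\<in>C. \<kappa> c \<noteq> \<kappa> w")
    case True
    then show ?thesis by simp
  next
    case False
    then obtain c where c: "c \<in> C" "\<kappa> c = \<kappa> w" by auto
    \<comment> \<open>A second clique vertex with the colour of \<open>w\<close> would be adjacent
      to \<open>c\<close> and have the same colour; so \<open>c\<close> is the only failure and both
      sides of \<open>count\<close> are 0.\<close>
    have "\<kappa> d \<noteq> \<kappa> w" if "d \<in> C - {c}" for d
    proof -
      have "{d, c} \<in> E" using that c clique by auto
      then have "\<kappa> d \<noteq> \<kappa> c" using \<open>\<kappa> \<in> ?c E\<close> by (simp add: proper_colourings_def)
      then show ?thesis using c(2) by simp
    qed
    then have "(\<Sum>d\<in>C - {c}. of_bool (\<kappa> d \<noteq> \<kappa> w)) = int (card C) - 1"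
      using c(1) finC card_gt_0_iff[of C] by (auto simp: of_nat_diff)
    moreover have "(\<Sum>d\<in>C. of_bool (\<kappa> d \<noteq> \<kappa> w)) = (\<Sum>d\<in>C - {c}. of_bool (\<kappa> d \<noteq> \<kappa> w) :: int)"
      using c by (intro sum.mono_neutral_right finC) auto
    ultimately show ?thesis using False by simp
  qed
  have "int (card (?c (E \<union> (\<lambda>c. {c, w}) ` C))) =
      (\<Sum>\<kappa>\<in>?c E. (\<Sum>c\<in>C. of_bool (\<kappa> c \<noteq> \<kappa> w)) - (int (card C) - 1))"
    unfolding all card_filter using count by (rule sum.cong[OF refl])
  also have "\<dots> = (\<Sum>c\<in>C. int (card (?c (insert {c, w} E)))) - (int (card C) - 1) * int (card (?c E))"
    unfolding ins card_filter by (simp add: sum_subtractf mult.commute sum.swap[of _ C])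
  finally show "coeff (chromatic_sf (V, E \<union> (\<lambda>c. {c, w}) ` C)) M =
      coeff ((\<Sum>c\<in>C. chromatic_sf (V, insert {c, w} E)) - (of_nat (card C) - 1) * chromatic_sf (V, E)) M"
    using V by (simp add: coeff_minus coeff_sum coeff_of_nat_mult left_diff_distrib coeff_chromatic_sf)
qed

section \<open>Decomposition of the lollipop graph\<close>

lemma complete_graph_Suc:
  "complete_graph (Suc k) =
    (insert k (fst (complete_graph k)), snd (complete_graph k) \<union> (\<lambda>c. {c, k}) ` {..<k})"
proof -
  have "e \<in> snd (complete_graph k) \<union> (\<lambda>c. {c, k}) ` {..<k}"
    if e: "e \<subseteq> {..<Suc k}" "card e = 2" for e
  proof -
    \<comment> \<open>With the endpoints ordered, only \<open>b\<close> can be the new vertex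
      \<open>k\<close>.\<close>
    obtain a b where ab: "e = {a, b}" "a < b"
      using e(2) by (metis card_2_iff insert_commute linorder_neqE_nat)
    show ?thesis
    proof (cases "b = k")
      case True
      then show ?thesis using ab by auto
    next
      case False
      then have "e \<subseteq> {..<k}" using ab e(1) by auto
      then show ?thesis using e(2) by (simp add: complete_graph_def)
    qed
  qed
  then show ?thesis by (auto simp: complete_graph_def)
qed

lemma shifted_path_Suc:
  "(`) ((+) k) ` snd (path_graph (Suc n)) =
    (if n = 0 then {} else insert {k, Suc k} ((`) ((+) (Suc k)) ` snd (path_graph n)))"
proof -
  have "{{i, Suc i} | i. Suc i < Suc n} = (\<lambda>i. {i, Suc i}) ` {..<n}" for n by auto
  \<comment> \<open>Truncated subtraction covers the empty path.\<close>
  then have path: "snd (path_graph n) = (\<lambda>i. {i, Suc i}) ` {..<n - 1}" for n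
    by (cases n) (auto simp: path_graph_def)
  show ?thesis
    by (cases n) (auto simp: path image_image lessThan_Suc_eq_insert_0)
qed

lemma shifted_interval_Suc: "(+) k ` {..<Suc n} = insert k ((+) (Suc k) ` {..<n})"
  by (auto simp: lessThan_Suc_eq_insert_0 image_image)

text \<open>The clique vertex \<open>k\<close> that carries the stick is counted as the first vertex
  of the path instead: the bridge becomes a path edge, and the clique edges at \<open>k\<close>
  become the joins from \<open>k\<close> to the smaller clique.\<close>

lemma lollipop_graph_Suc:
  "lollipop_graph (Suc k) n =
    (fst (complete_graph k) \<union> (+) k ` fst (path_graph (Suc n)),
     snd (complete_graph k) \<union> (`) ((+) k) ` snd (path_graph (Suc n)) \<union> (\<lambda>c. {c, k}) ` {..<k})"
  unfolding lollipop_graph_def complete_graph_Suc shifted_path_Suc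
  by (auto simp: complete_graph_def path_graph_def shifted_interval_Suc)

section \<open>The recurrence between lollipops\<close>

theorem theorem3p2:
  fixes m n :: nat
  assumes "m \<ge> 2"
  shows "chromatic_sf (lollipop_graph m n) =
    of_nat (m - 1) * chromatic_sf (lollipop_graph (m - 1) (n + 1))
    - of_nat (m - 2) * chromatic_sf (complete_graph (m - 1)) * chromatic_sf (path_graph (n + 1))"
proof -
  obtain k where k: "m = Suc k" "k \<ge> 1" using assms by (cases m) auto
  \<comment> \<open>The path on the vertices \<open>k\<close>, ..., \<open>k + n\<close>, disjoint
    from the clique on \<open>{..<k}\<close>; its end \<open>k\<close> will play the role of
    \<open>w\<close>.\<close>
  let ?Q = "((+) k ` fst (path_graph (Suc n)), (`) ((+) k) ` snd (path_graph (Suc n)))"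
  define V where "V = fst (complete_graph k) \<union> fst ?Q"
  define E where "E = snd (complete_graph k) \<union> snd ?Q"
  have Q: "simple_graph ?Q"
    using simple_graph_path[of "Suc n"] by (auto simp: simple_graph_def card_image)
  have "chromatic_sf (V, E) = chromatic_sf (complete_graph k) * chromatic_sf ?Q"
    unfolding V_def E_def
    by (rule chromatic_sf_disjoint_union[OF simple_graph_complete Q]) (auto simp: complete_graph_def)
  also have "chromatic_sf ?Q = chromatic_sf (path_graph (Suc n))"
    by (rule chromatic_sf_image[OF simple_graph_path]) simp
  finally have union: "chromatic_sf (V, E) = chromatic_sf (complete_graph k) * chromatic_sf (path_graph (Suc n))" .
  have lollipop: "lollipop_graph k (Suc n) = (V, insert {k - 1, k} E)"
    using k(2) by (auto simp: lollipop_graph_def V_def E_def)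
  have attach: "chromatic_sf (V, insert {c, k} E) = chromatic_sf (lollipop_graph k (Suc n))" if c: "c < k" for c
  proof -
    \<comment> \<open>This transposition is an automorphism of \<open>(V, E)\<close>: it permutes
      the clique and fixes the path pointwise. It carries the bridge \<open>{k - 1, k}\<close> to
      \<open>{c, k}\<close>.\<close>
    let ?t = "transpose c (k - 1)"
    have fixed: "?t x = x" if "x \<ge> k" for x using that c k(2) by (auto simp: transpose_def)
    have img: "?t ` {..<k} = {..<k}" using c by simp
    have complete_sub: "(`) ?t ` snd (complete_graph k) \<subseteq> snd (complete_graph k)"
    proof (rule image_subsetI)
      fix e assume "e \<in> snd (complete_graph k)"
      then have "e \<subseteq> {..<k}" "card e = 2" by (auto simp: complete_graph_def)
      then show "?t ` e \<in> snd (complete_graph k)"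
        using img image_mono[of e "{..<k}" ?t] by (simp add: complete_graph_def card_image inj_on_transpose)
    qed
    have invol: "(`) ?t ` ((`) ?t ` X) = X" for X
      by (simp add: image_image)
    \<comment> \<open>Applying the involution to the inclusion just proved yields the reverse
      inclusion.\<close>
    have complete: "(`) ?t ` snd (complete_graph k) = snd (complete_graph k)"
      using complete_sub image_mono[OF complete_sub, of "(`) ?t"] unfolding invol by (rule equalityI)
    have "?t ` ((+) k ` d) = (+) k ` d" for d
      by (simp add: image_image fixed del: One_nat_def)
    then have path: "(`) ?t ` snd ?Q = snd ?Q"
      by (simp add: image_image)
    have "?t ` {k - 1, k} = {c, k}" using fixed[of k] by simp
    then have edges: "(`) ?t ` insert {k - 1, k} E = insert {c, k} E"
      by (simp only: E_def image_insert image_Un complete path)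
    have "?t ` fst ?Q = fst ?Q" by (simp add: image_image fixed del: One_nat_def)
    moreover have "?t ` fst (complete_graph k) = fst (complete_graph k)"
      using img by (simp add: complete_graph_def)
    ultimately have vertices: "?t ` V = V"
      by (simp only: V_def image_Un)
    show ?thesis
      using chromatic_sf_image[OF simple_graph_lollipop[of k "Suc n"], of ?t] edges vertices
      by (simp add: lollipop inj_on_transpose)
  qed
  have "lollipop_graph m n = (V, E \<union> (\<lambda>c. {c, k}) ` {..<k})"
    unfolding k(1) lollipop_graph_Suc V_def E_def by simp
  also have "chromatic_sf \<dots> =
      (\<Sum>c<k. chromatic_sf (V, insert {c, k} E)) - (of_nat (card {..<k}) - 1) * chromatic_sf (V, E)"
    by (rule chromatic_sf_join_vertex_clique) (auto simp: V_def E_def complete_graph_def path_graph_def)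
  \<comment> \<open>All \<open>k\<close> summands are equal by \<open>attach\<close>, and
    \<open>k \<ge> 1\<close> turns the ring difference into \<open>of_nat (k - 1)\<close>, where
    \<open>k - 1\<close> is \<open>m - 2\<close>.\<close>
  also have "\<dots> = of_nat k * chromatic_sf (lollipop_graph k (Suc n)) - of_nat (k - 1) * chromatic_sf (V, E)"
    using k(2) by (simp add: attach of_nat_diff)
  finally show ?thesis
    by (simp add: k(1) union mult.assoc)
qed

end
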